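(* Optimal evenly-spaced policies approximate the joint replenishment problem within factor of at most $1.01915$; that is, the infimum of the costs of evenly-spaced policies is at most $1.01915 \cdot \inf_T F(T)$, where the latter infimum is over all replenishment policies.
   Context: Joint replenishment problem (variable base): there are $n$ commodities; commodity $i \in [n]$ has ordering cost $K_i > 0$ and holding-cost parameter $H_i > 0$, and there is a joint ordering cost $K_0 > 0$. A replenishment policy is a vector $T = (T_1,\ldots,T_n)$ of positive reals, commodity $i$ being ordered at times $0, T_i, 2T_i, \ldots$. Its marginal cost is $C_i(T_i) = \frac{K_i}{T_i} + H_i T_i$. For $\Delta \geq 0$, $N(T,\Delta) = \left| \bigcup_{i\in[n]} \{0, T_i, \ldots, \lfloor \Delta/T_i \rfloor T_i\} \right|$, $J(T) = K_0 \lim_{\Delta\to\infty} N(T,\Delta)/\Delta$, and $F(T) = J(T) + \sum_i C_i(T_i)$. An evenly-spaced policy is specified by a spacing parameter $\Delta > 0$ (a decision variable) together with time intervals $T_1,\ldots,T_n$, each a positive integer multiple of $\Delta$; joint orders are placed at every integer multiple of $\Delta$, so its cost is $\frac{K_0}{\Delta} + \sum_{i\in[n]} C_i(T_i)$. *)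

theory Defs
  imports Complex_Main
begin

text \<open>Commodities are indexed by \<open>{1..n}\<close>. A vector indexed by commodities is a function on
  \<open>nat\<close>; its values outside \<open>{1..n}\<close> are never used.\<close>

definition marginal_cost :: "real \<Rightarrow> real \<Rightarrow> real \<Rightarrow> real" where
  "marginal_cost Ki Hi t = Ki / t + Hi * t"

definition replenishment_policy :: "nat \<Rightarrow> (nat \<Rightarrow> real) \<Rightarrow> bool" where
  "replenishment_policy n T \<longleftrightarrow> (\<forall>i\<in>{1..n}. T i > 0)"

definition order_times :: "real \<Rightarrow> real \<Rightarrow> real set" where
  "order_times t \<Delta> = {of_int k * t |k. 0 \<le> k \<and> k \<le> \<lfloor>\<Delta> / t\<rfloor>}"

definition num_joint_orders :: "nat \<Rightarrow> (nat \<Rightarrow> real) \<Rightarrow> real \<Rightarrow> nat" where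
  "num_joint_orders n T \<Delta> = card (\<Union>i\<in>{1..n}. order_times (T i) \<Delta>)"

definition joint_cost :: "nat \<Rightarrow> real \<Rightarrow> (nat \<Rightarrow> real) \<Rightarrow> real" where
  "joint_cost n K0 T = K0 * Lim at_top (\<lambda>\<Delta>::real. real (num_joint_orders n T \<Delta>) / \<Delta>)"

definition policy_cost ::
  "nat \<Rightarrow> real \<Rightarrow> (nat \<Rightarrow> real) \<Rightarrow> (nat \<Rightarrow> real) \<Rightarrow> (nat \<Rightarrow> real) \<Rightarrow> real" where
  "policy_cost n K0 K H T = joint_cost n K0 T + (\<Sum>i=1..n. marginal_cost (K i) (H i) (T i))"

definition evenly_spaced_policy :: "nat \<Rightarrow> real \<Rightarrow> (nat \<Rightarrow> real) \<Rightarrow> bool" where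
  "evenly_spaced_policy n \<Delta> T \<longleftrightarrow>
     \<Delta> > 0 \<and> (\<forall>i\<in>{1..n}. \<exists>k::nat. k > 0 \<and> T i = real k * \<Delta>)"

text \<open>Joint orders are charged at every multiple of \<open>\<Delta>\<close>, even at those where no commodity is
  ordered, so the first summand is not \<open>joint_cost\<close>.\<close>

definition evenly_spaced_cost ::
  "nat \<Rightarrow> real \<Rightarrow> (nat \<Rightarrow> real) \<Rightarrow> (nat \<Rightarrow> real) \<Rightarrow> real \<Rightarrow> (nat \<Rightarrow> real) \<Rightarrow> real" where
  "evenly_spaced_cost n K0 K H \<Delta> T = K0 / \<Delta> + (\<Sum>i=1..n. marginal_cost (K i) (H i) (T i))"

end

theory Submission
  imports Defs
begin

text \<open>Let \<open>\<tau>\<close> be the smallest interval of a policy \<open>T\<close>. Then the joint cost is at least \<open>K0 / \<tau>\<close>, and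
  even \<open>5 / 4 * K0 / \<tau>\<close> if some interval lies strictly between \<open>\<tau>\<close> and \<open>2 * \<tau>\<close>. In either case a
  fixed probability distribution on spacing parameters \<open>d j * \<tau>\<close>, together with a suitable rounding
  of each interval to a multiple of the spacing, has expected cost at most 1.01915 times this lower
  bound on the cost of \<open>T\<close>: if no interval lies in the gap, spacings close to \<open>\<tau>\<close> work, and otherwise
  the additional joint cost pays for a spacing as small as \<open>0.57 * \<tau>\<close>. For fixed multipliers the
  expected marginal cost is compared with the optimum through a convex quadratic in
  \<open>sqrt (K / H)\<close>, so that finitely many endpoint evaluations suffice.\<close>

subsection \<open>Density of joint orders\<close>

text \<open>Each full period contributes the same count, so only the last incomplete period, of
  length below \<open>p\<close>, deviates from linear growth. Index 0 is left out of the periodicity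
  because coincidences at time 0 need not recur.\<close>

lemma periodic_card_linear:
  fixes A :: "nat set"
  assumes "p > 0" and per: "\<And>k. k \<ge> 1 \<Longrightarrow> k + p \<in> A \<longleftrightarrow> k \<in> A"
  shows "\<exists>\<alpha> B. \<forall>n. \<bar>real (card (A \<inter> {1..n})) - \<alpha> * real n\<bar> \<le> B"
proof -
  define c where "c n = card (A \<inter> {1..n})" for n
  have step: "c (n + p) = c n + c p" for n
  proof -
    have "A \<inter> {1..n + p} = A \<inter> {1..p} \<union> (\<lambda>k. k + p) ` (A \<inter> {1..n})"
    proof (intro equalityI subsetI)
      fix y assume y: "y \<in> A \<inter> {1..n + p}"
      show "y \<in> A \<inter> {1..p} \<union> (\<lambda>k. k + p) ` (A \<inter> {1..n})"
      proof (cases "y \<le> p")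
        case False
        then have "y = (y - p) + p" "y - p \<in> A \<inter> {1..n}"
          using y per[of "y - p"] by auto
        then show ?thesis by blast
      qed (use y in auto)
    qed (use per in auto)
    then have "c (n + p) = card (A \<inter> {1..p} \<union> (\<lambda>k. k + p) ` (A \<inter> {1..n}))"
      by (simp add: c_def)
    also have "\<dots> = c p + card ((\<lambda>k. k + p) ` (A \<inter> {1..n}))"
      unfolding c_def by (rule card_Un_disjoint) auto
    also have "card ((\<lambda>k. k + p) ` (A \<inter> {1..n})) = c n"
      unfolding c_def by (rule card_image) (auto simp: inj_on_def)
    finally show ?thesis by simp
  qed
  have mult: "c (r + q * p) = c r + q * c p" for q r
  proof (induction q)
    case (Suc q)
    then show ?case using step[of "r + q * p"] by (simp add: algebra_simps)
  qed simp
  have le: "c n \<le> n" for n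
  proof -
    have "c n \<le> card {1..n}" unfolding c_def by (intro card_mono) auto
    then show ?thesis by simp
  qed
  \<comment> \<open>The density is the fraction of hits within one period.\<close>
  define \<alpha> where "\<alpha> = real (c p) / real p"
  have \<alpha>: "0 \<le> \<alpha>" "\<alpha> \<le> 1" "\<alpha> * p = c p"
    using le[of p] \<open>p > 0\<close> by (auto simp: \<alpha>_def)
  have "\<bar>real (c n) - \<alpha> * real n\<bar> \<le> real p" for n
  proof -
    define q r where "q = n div p" and "r = n mod p"
    have n: "n = r + q * p" and r: "r < p" using \<open>p > 0\<close> by (auto simp: q_def r_def)
    have "real (c n) - \<alpha> * n = c r + q * c p - \<alpha> * r - q * (\<alpha> * p)"
      unfolding n mult by (simp add: algebra_simps)
    then have "real (c n) - \<alpha> * n = c r - \<alpha> * r" using \<alpha> by simp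
    moreover have "0 \<le> \<alpha> * r" "\<alpha> * r \<le> r" using \<alpha> by (auto simp: mult_left_le_one_le)
    ultimately show ?thesis using le[of r] r by linarith
  qed
  then show ?thesis unfolding c_def by blast
qed

text \<open>If some positive multiple of \<open>t\<close> is also a multiple of \<open>s\<close>,
  shifting by it preserves coincidences in both directions. Otherwise no \<open>k\<close> from 1 on
  gives a coincidence, and the period 1 works.\<close>

lemma common_multiple_periodic:
  fixes s t :: real
  assumes "s > 0" "t > 0"
  shows "\<exists>p>0. \<forall>k\<ge>1. (\<exists>m::nat. real (k + p) * t = real m * s) \<longleftrightarrow> (\<exists>m::nat. real k * t = real m * s)"
proof (cases "\<exists>d\<ge>1. \<exists>m::nat. real d * t = real m * s")
  case True
  then obtain d m where dm: "d \<ge> 1" "real d * t = real m * s" by blast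
  have "(\<exists>m::nat. real (k + d) * t = real m * s) \<longleftrightarrow> (\<exists>m::nat. real k * t = real m * s)"
    if "k \<ge> 1" for k
  proof
    assume "\<exists>m::nat. real (k + d) * t = real m * s"
    then obtain l :: nat where l: "real (k + d) * t = real l * s" by blast
    have eq: "real k * t = (real l - real m) * s" using l dm by (simp add: algebra_simps)
    have "real k * t > 0" using that assms by simp
    then have "l \<ge> m" using eq assms by (simp add: zero_less_mult_iff)
    then show "\<exists>m::nat. real k * t = real m * s" using eq by (intro exI[of _ "l - m"]) simp
  next
    assume "\<exists>m::nat. real k * t = real m * s"
    then obtain l :: nat where "real k * t = real l * s" by blast
    then have "real (k + d) * t = real (l + m) * s" using dm by (simp add: algebra_simps)
    then show "\<exists>m::nat. real (k + d) * t = real m * s" by blast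
  qed
  then show ?thesis using dm(1) by (intro exI[of _ d]) auto
next
  case False
  then show ?thesis by (intro exI[of _ 1]) (metis le_add1 le_trans zero_less_one)
qed

text \<open>These indices are the orders at multiples of \<open>t\<close> that are new relative to
  the commodities in \<open>I\<close>. In the induction, the product of two periods serves as a
  common period.\<close>

lemma avoiding_multiples_periodic:
  fixes T :: "'a \<Rightarrow> real" and t :: real
  assumes "finite I" "\<forall>j\<in>I. T j > 0" "t > 0"
  shows "\<exists>p>0. \<forall>k\<ge>1. k + p \<in> {k::nat. \<forall>j\<in>I. \<forall>m::nat. real k * t \<noteq> real m * T j}
      \<longleftrightarrow> k \<in> {k. \<forall>j\<in>I. \<forall>m::nat. real k * t \<noteq> real m * T j}"
  using assms
proof (induction I rule: finite_induct)
  case empty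
  then show ?case by (intro exI[of _ 1]) simp
next
  case (insert i I)
  define P where "P k \<longleftrightarrow> (\<forall>j\<in>I. \<forall>m::nat. real k * t \<noteq> real m * T j)" for k
  define Q where "Q k \<longleftrightarrow> (\<exists>m::nat. real k * t = real m * T i)" for k
  obtain p where p: "p > 0" "\<And>k. k \<ge> 1 \<Longrightarrow> P (k + p) \<longleftrightarrow> P k"
    using insert unfolding P_def by auto
  obtain q where q: "q > 0" "\<And>k. k \<ge> 1 \<Longrightarrow> Q (k + q) \<longleftrightarrow> Q k"
    using common_multiple_periodic[of "T i" t] insert.prems unfolding Q_def by auto
  have P: "P (k + l * p) \<longleftrightarrow> P k" if "k \<ge> 1" for k l
    using that by (induction l) (simp_all add: p(2) add.assoc[symmetric] add.commute[of p])
  have Q: "Q (k + l * q) \<longleftrightarrow> Q k" if "k \<ge> 1" for k l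
    using that by (induction l) (simp_all add: q(2) add.assoc[symmetric] add.commute[of q])
  have "p * q > 0" using p q by simp
  moreover have "\<forall>k\<ge>1. (P (k + p * q) \<and> \<not> Q (k + p * q)) \<longleftrightarrow> (P k \<and> \<not> Q k)"
    using P[of _ q] Q[of _ p] by (metis mult.commute)
  ultimately show ?case
    unfolding P_def Q_def by (intro exI[of _ "p * q"]) auto
qed

section \<open>Counting order times up to a horizon\<close>

lemma order_times_eq_image:
  assumes "t > 0" "D \<ge> 0"
  shows "order_times t D = (\<lambda>k. real k * t) ` {0..nat \<lfloor>D / t\<rfloor>}"
proof (intro equalityI subsetI)
  fix y assume "y \<in> order_times t D"
  then obtain k :: int where "y = of_int k * t" "0 \<le> k" "k \<le> \<lfloor>D / t\<rfloor>"
    unfolding order_times_def by blast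
  then have "y = real (nat k) * t" "nat k \<in> {0..nat \<lfloor>D / t\<rfloor>}" by auto
  then show "y \<in> (\<lambda>k. real k * t) ` {0..nat \<lfloor>D / t\<rfloor>}" by blast
next
  fix y assume "y \<in> (\<lambda>k. real k * t) ` {0..nat \<lfloor>D / t\<rfloor>}"
  then obtain k where "y = real k * t" "k \<in> {0..nat \<lfloor>D / t\<rfloor>}" by (rule imageE)
  moreover have "0 \<le> \<lfloor>D / t\<rfloor>" using assms by simp
  ultimately have "y = of_int (int k) * t" "0 \<le> int k" "int k \<le> \<lfloor>D / t\<rfloor>"
    by (auto simp: le_nat_iff)
  then show "y \<in> order_times t D" unfolding order_times_def by blast
qed

lemma mem_order_times:
  assumes "t > 0" "D \<ge> 0"
  shows "y \<in> order_times t D \<longleftrightarrow> (\<exists>k::nat. y = real k * t \<and> y \<le> D)"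
proof -
  have iff: "k \<le> nat \<lfloor>D / t\<rfloor> \<longleftrightarrow> real k * t \<le> D" for k :: nat
    using assms by (simp add: le_nat_iff le_floor_iff pos_le_divide_eq)
  show ?thesis
    by (simp only: order_times_eq_image[OF assms] image_iff Bex_def atLeastAtMost_iff iff) blast
qed

lemma finite_order_times: "t > 0 \<Longrightarrow> D \<ge> 0 \<Longrightarrow> finite (order_times t D)"
  by (simp add: order_times_eq_image)

text \<open>Adding a commodity adds exactly its new order times, whose indices form a periodic set
  and so grow linearly. This yields the existence of the limit in \<open>joint_cost\<close>, without
  which \<open>Lim\<close> would say nothing.\<close>

lemma card_union_order_times_linear:
  assumes "finite I" "\<forall>i\<in>I. T i > (0::real)"
  shows "\<exists>\<alpha> B. \<forall>D\<ge>0. \<bar>real (card (\<Union>i\<in>I. order_times (T i) D)) - \<alpha> * D\<bar> \<le> B"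
  using assms
proof (induction I rule: finite_induct)
  case empty
  then show ?case by (intro exI[of _ 0]) simp
next
  case (insert i I)
  define t where "t = T i"
  have t: "t > 0" using insert.prems t_def by simp
  define S where "S = {k::nat. \<forall>j\<in>I. \<forall>m::nat. real k * t \<noteq> real m * T j}"
  obtain \<alpha> B where IH: "\<And>D. D \<ge> 0 \<Longrightarrow> \<bar>real (card (\<Union>i\<in>I. order_times (T i) D)) - \<alpha> * D\<bar> \<le> B"
    using insert by auto
  obtain p where "p > 0" "\<forall>k\<ge>1. k + p \<in> S \<longleftrightarrow> k \<in> S"
    using avoiding_multiples_periodic[of I T t] insert t unfolding S_def by auto
  then obtain \<beta> B' where S: "\<And>n. \<bar>real (card (S \<inter> {1..n})) - \<beta> * real n\<bar> \<le> B'"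
    using periodic_card_linear[of p S] by auto
  \<comment> \<open>The error terms come from the old commodities (\<open>B\<close>), the periodic
    count (\<open>B'\<close>), the order at time 0 (1), and rounding \<open>D / t\<close> down to an
    integer (the absolute value of \<beta>).\<close>
  have "\<bar>real (card (\<Union>i\<in>insert i I. order_times (T i) D)) - (\<alpha> + \<beta> / t) * D\<bar> \<le> B + B' + 1 + \<bar>\<beta>\<bar>"
    if D: "D \<ge> 0" for D
  proof -
    define N where "N = nat \<lfloor>D / t\<rfloor>"
    let ?U = "\<Union>i\<in>I. order_times (T i) D"
    have "order_times t D - ?U = (\<lambda>k. real k * t) ` (S \<inter> {0..N})"
    proof -
      have "real k * t \<in> ?U \<longleftrightarrow> k \<notin> S" if "k \<in> {0..N}" for k
      proof -
        have "real k * t \<in> order_times t D" using that by (auto simp: N_def order_times_eq_image t D)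
        then have "real k * t \<le> D" using mem_order_times[OF t D] by blast
        then show ?thesis using insert.prems D by (auto simp: S_def mem_order_times)
      qed
      then show ?thesis unfolding order_times_eq_image[OF t D] N_def[symmetric] by blast
    qed
    then have new: "card (order_times t D - ?U) = card (S \<inter> {0..N})"
      using t by (simp add: card_image inj_on_def)
    have "(\<Union>i\<in>insert i I. order_times (T i) D) = ?U \<union> (order_times t D - ?U)"
      by (auto simp: t_def)
    then have "card (\<Union>i\<in>insert i I. order_times (T i) D) = card (?U \<union> (order_times t D - ?U))"
      by simp
    also have "\<dots> = card ?U + card (order_times t D - ?U)"
      by (rule card_Un_disjoint) (use insert t D in \<open>auto simp: finite_order_times\<close>)
    finally have split: "card (\<Union>i\<in>insert i I. order_times (T i) D) = card ?U + card (S \<inter> {0..N})"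
      using new by simp
    have "S \<inter> {0..N} = S \<inter> {1..N} \<union> S \<inter> {0}" by auto
    then have "card (S \<inter> {0..N}) = card (S \<inter> {1..N}) + card (S \<inter> {0})"
      by (simp add: card_Un_disjoint disjoint_iff)
    moreover have "card (S \<inter> {0}) \<le> card {0::nat}" by (intro card_mono) auto
    ultimately have c: "\<bar>real (card (S \<inter> {0..N})) - real (card (S \<inter> {1..N}))\<bar> \<le> 1"
      by simp
    have "0 \<le> D / t" using D t by simp
    then have "\<bar>real N - D / t\<bar> \<le> 1" unfolding N_def by linarith
    then have "\<bar>\<beta>\<bar> * \<bar>real N - D / t\<bar> \<le> \<bar>\<beta>\<bar>" by (intro mult_left_le) auto
    then have "\<bar>\<beta> * real N - \<beta> / t * D\<bar> \<le> \<bar>\<beta>\<bar>"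
      by (simp add: abs_mult[symmetric] right_diff_distrib)
    then show ?thesis using IH[OF D] S[of N] c split by (simp add: distrib_right)
  qed
  then show ?case by blast
qed

text \<open>Linear growth identifies \<open>Lim\<close> with a true limit \<alpha>; a linear lower
  bound of larger slope would overtake the count for large \<open>D\<close>.\<close>

lemma joint_cost_ge:
  assumes "K0 \<ge> 0" and pos: "\<forall>i\<in>{1..n}. T i > 0"
    and lower: "\<And>D. D \<ge> 0 \<Longrightarrow> real (num_joint_orders n T D) \<ge> \<beta> * D - c"
  shows "joint_cost n K0 T \<ge> K0 * \<beta>"
proof -
  obtain \<alpha> B where lin: "\<And>D. D \<ge> 0 \<Longrightarrow> \<bar>real (num_joint_orders n T D) - \<alpha> * D\<bar> \<le> B"
    using card_union_order_times_linear[of "{1..n}" T] pos unfolding num_joint_orders_def by auto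
  have "((\<lambda>D. real (num_joint_orders n T D) / D - \<alpha>) \<longlongrightarrow> 0) at_top"
  proof (rule tendsto_0_le[where K = 1])
    show "\<forall>\<^sub>F D in at_top. norm (real (num_joint_orders n T D) / D - \<alpha>) \<le> norm (B / D) * 1"
      using eventually_gt_at_top[of 0]
    proof eventually_elim
      case (elim D)
      have "\<bar>real (num_joint_orders n T D) / D - \<alpha>\<bar> = \<bar>real (num_joint_orders n T D) - \<alpha> * D\<bar> / D"
        using elim by (simp add: abs_div_pos diff_divide_distrib)
      also have "\<dots> \<le> \<bar>B\<bar> / D"
        using lin[of D] elim by (intro divide_right_mono) linarith+
      finally show ?case using elim by simp
    qed
    show "((\<lambda>D. B / D) \<longlongrightarrow> 0) at_top"
      by (intro tendsto_divide_0[OF tendsto_const] filterlim_at_top_imp_at_infinity filterlim_ident)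
  qed
  then have "((\<lambda>D. real (num_joint_orders n T D) / D) \<longlongrightarrow> \<alpha>) at_top"
    by (simp add: LIM_zero_cancel)
  then have J: "joint_cost n K0 T = K0 * \<alpha>"
    unfolding joint_cost_def by (simp add: tendsto_Lim)
  have "\<beta> \<le> \<alpha>"
  proof (rule ccontr)
    assume "\<not> \<beta> \<le> \<alpha>"
    \<comment> \<open>At this horizon the gap between the two slopes exceeds both additive errors
      together.\<close>
    define D where "D = (\<bar>B\<bar> + \<bar>c\<bar> + 1) / (\<beta> - \<alpha>)"
    have "D \<ge> 0" "(\<beta> - \<alpha>) * D = \<bar>B\<bar> + \<bar>c\<bar> + 1" using \<open>\<not> \<beta> \<le> \<alpha>\<close> by (auto simp: D_def)
    then show False using lin[of D] lower[of D] by (simp add: algebra_simps)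
  qed
  then show ?thesis unfolding J using assms(1) by (rule mult_left_mono)
qed

section \<open>Order counts for one and for two commodities\<close>

lemma card_order_times_ge:
  assumes "t > 0" "D \<ge> 0"
  shows "real (card (order_times t D)) \<ge> D / t"
proof -
  have "card (order_times t D) = nat \<lfloor>D / t\<rfloor> + 1"
    unfolding order_times_eq_image[OF assms] using assms by (subst card_image) (auto simp: inj_on_def)
  then show ?thesis by linarith
qed

text \<open>Of two consecutive multiples of \<open>x\<close> at most one is a multiple of \<open>t\<close>, since their difference
  \<open>x\<close> lies strictly between \<open>t\<close> and \<open>2 * t\<close>. So the density of the orders at multiples of \<open>x\<close>
  alone is at least \<open>1 / (2 * x) > 1 / (4 * t)\<close>.\<close>

lemma card_two_order_times_ge:
  assumes "0 < t" "t < x" "x < 2 * t" "D \<ge> 0"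
  shows "real (card (order_times t D \<union> order_times x D)) \<ge> 5 / 4 / t * D - 1"
proof -
  have x: "x > 0" using assms by linarith
  \<comment> \<open>The indices from 0 to the floor of \<open>D / x\<close> contain \<open>M\<close>
    disjoint pairs \<open>2 * j\<close>, \<open>2 * j + 1\<close>.\<close>
  define M where "M = (nat \<lfloor>D / x\<rfloor> + 1) div 2"
  have not_both: "\<not> (real k * x \<in> order_times t D \<and> real (k + 1) * x \<in> order_times t D)" for k
  proof
    assume "real k * x \<in> order_times t D \<and> real (k + 1) * x \<in> order_times t D"
    then obtain m m' :: nat where "real k * x = m * t" "real (k + 1) * x = m' * t"
      using assms by (auto simp: mem_order_times)
    then have "x = (real m' - real m) * t" by (simp add: algebra_simps)
    then have "1 * t < (real m' - real m) * t" "(real m' - real m) * t < 2 * t" using assms by auto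
    then have "1 < real m' - real m" "real m' - real m < 2"
      using assms(1) by (auto simp only: mult_less_cancel_right_pos)
    then have "m + 1 < m'" "m' < m + 2" by linarith+
    then show False by simp
  qed
  \<comment> \<open>From each pair, \<open>e\<close> selects an index whose order time is not an
    order time of \<open>t\<close>.\<close>
  define e where "e j = (if real (2 * j) * x \<in> order_times t D then 2 * j + 1 else 2 * j)" for j
  have e_div: "e j div 2 = j" for j by (simp add: e_def)
  have e_le: "e j \<le> nat \<lfloor>D / x\<rfloor>" if "j < M" for j using that unfolding e_def M_def by auto
  have e_notin: "real (e j) * x \<notin> order_times t D" for j
    using not_both[of "2 * j"] by (auto simp: e_def)
  have inj: "inj_on (\<lambda>j. real (e j) * x) {..<M}"
    using x by (intro inj_onI) (simp, metis e_div)
  have sub: "(\<lambda>j. real (e j) * x) ` {..<M} \<subseteq> order_times x D - order_times t D"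
    unfolding order_times_eq_image[OF x assms(4)] using e_le e_notin by fastforce
  have fin: "finite (order_times t D)" "finite (order_times x D)"
    using assms x by (auto simp: finite_order_times)
  have "M \<le> card (order_times x D - order_times t D)"
    using card_mono[OF _ sub] fin card_image[OF inj] by simp
  moreover have "card (order_times t D \<union> order_times x D)
      = card (order_times t D) + card (order_times x D - order_times t D)"
    using fin by (subst Un_Diff_cancel[symmetric], subst card_Un_disjoint) auto
  moreover have "real M \<ge> D / x / 2 - 1"
  proof -
    have "0 \<le> D / x" using assms x by simp
    then have "real (nat \<lfloor>D / x\<rfloor>) \<ge> D / x - 1" by linarith
    moreover have "2 * M \<ge> nat \<lfloor>D / x\<rfloor>" unfolding M_def by linarith
    then have "2 * real M \<ge> real (nat \<lfloor>D / x\<rfloor>)" by linarith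
    ultimately show ?thesis by argo
  qed
  moreover have "D / x \<ge> D / (2 * t)" using assms x by (intro divide_left_mono) auto
  ultimately show ?thesis using card_order_times_ge[OF assms(1,4)] by simp
qed

lemma joint_cost_ge_single:
  assumes "K0 \<ge> 0" "\<forall>i\<in>{1..n}. T i > 0" "i \<in> {1..n}"
  shows "joint_cost n K0 T \<ge> K0 / T i"
proof -
  have "real (num_joint_orders n T D) \<ge> 1 / T i * D - 0" if "D \<ge> 0" for D
  proof -
    have "card (order_times (T i) D) \<le> num_joint_orders n T D"
      unfolding num_joint_orders_def
      by (intro card_mono) (use assms that in \<open>auto simp: finite_order_times\<close>)
    then show ?thesis using card_order_times_ge[of "T i" D] assms that by simp
  qed
  from joint_cost_ge[OF assms(1,2) this] show ?thesis by simp
qed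

lemma joint_cost_ge_two:
  assumes "K0 \<ge> 0" "\<forall>i\<in>{1..n}. T i > 0" "i \<in> {1..n}" "l \<in> {1..n}" "T i < T l" "T l < 2 * T i"
  shows "joint_cost n K0 T \<ge> 5 / 4 * K0 / T i"
proof -
  have "real (num_joint_orders n T D) \<ge> 5 / 4 / T i * D - 1" if "D \<ge> 0" for D
  proof -
    have "card (order_times (T i) D \<union> order_times (T l) D) \<le> num_joint_orders n T D"
      unfolding num_joint_orders_def
      by (intro card_mono) (use assms that in \<open>auto simp: finite_order_times\<close>)
    then show ?thesis using card_two_order_times_ge[of "T i" "T l" D] assms that by simp
  qed
  from joint_cost_ge[OF assms(1,2) this] show ?thesis by simp
qed

subsection \<open>Rounding intervals to a random grid\<close>

lemma quadratic_le_on_interval: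
  fixes a b v s :: real
  assumes "a \<ge> 0" "lo \<le> s" "s \<le> hi" "a * lo\<^sup>2 + b \<le> 2 * v * lo" "a * hi\<^sup>2 + b \<le> 2 * v * hi"
  shows "a * s\<^sup>2 + b \<le> 2 * v * s"
proof (cases "lo = hi")
  case False
  \<comment> \<open>Convexity made explicit: the chord through the endpoint values minus a
    nonnegative multiple of \<open>a\<close>.\<close>
  have "(hi - lo) * (a * s\<^sup>2 + b - 2 * v * s)
      = (hi - s) * (a * lo\<^sup>2 + b - 2 * v * lo) + (s - lo) * (a * hi\<^sup>2 + b - 2 * v * hi)
        - a * ((hi - lo) * (s - lo) * (hi - s))"
    by (simp add: power2_eq_square algebra_simps)
  also have "\<dots> \<le> 0"
  proof -
    have "(hi - s) * (a * lo\<^sup>2 + b - 2 * v * lo) \<le> 0" "(s - lo) * (a * hi\<^sup>2 + b - 2 * v * hi) \<le> 0"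
      using assms by (auto intro: mult_nonneg_nonpos)
    moreover have "a * ((hi - lo) * (s - lo) * (hi - s)) \<ge> 0" using assms by auto
    ultimately show ?thesis by linarith
  qed
  finally have "a * s\<^sup>2 + b - 2 * v * s \<le> 0"
    using False assms by (simp add: mult_le_0_iff)
  then show ?thesis by simp
qed (use assms in auto)

text \<open>Rounding to the nearest multiple \<open>y\<close> moves \<open>s\<close> by at most
  \<open>d / 2\<close>, while \<open>s\<close> and \<open>y\<close> are both at least
  \<open>3 * d\<close>. Hence the loss is at most the factor 1 + 1/72. With \<open>2 * d\<close> in
  place of \<open>3 * d\<close> the same estimate would give only 1 + 1/32, which is too
  much.\<close>

lemma nearest_multiple:
  fixes d s :: real
  assumes "d > 0" "s \<ge> 3 * d"
  shows "\<exists>k::nat. k > 0 \<and> s\<^sup>2 / (real k * d) + real k * d \<le> 2 * 1.01915 * s"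
proof -
  define k where "k = nat \<lfloor>s / d + 1 / 2\<rfloor>"
  have "s / d \<ge> 3" using assms by (simp add: pos_le_divide_eq)
  then have k: "k \<ge> 3" "\<bar>s / d - real k\<bar> \<le> 1 / 2" unfolding k_def by linarith+
  define y where "y = real k * d"
  have y: "y \<ge> 3 * d" "y > 0" using k assms by (auto simp: y_def)
  have "\<bar>s - y\<bar> = \<bar>s / d - real k\<bar> * d"
    using assms by (simp add: y_def abs_mult[symmetric] left_diff_distrib abs_mult_pos)
  then have "\<bar>s - y\<bar> \<le> \<bar>d / 2\<bar>" using mult_right_mono[OF k(2), of d] assms by simp
  then have "(s - y)\<^sup>2 \<le> (d / 2)\<^sup>2" by (simp only: abs_le_square_iff)
  moreover have "(3 * d) * (3 * d) \<le> s * y" using assms y by (intro mult_mono) auto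
  moreover have "(s - y)\<^sup>2 = s\<^sup>2 + y\<^sup>2 - 2 * (s * y)" "(d / 2)\<^sup>2 = d\<^sup>2 / 4" "(3 * d) * (3 * d) = 9 * d\<^sup>2"
    by (simp_all add: power2_eq_square algebra_simps)
  moreover have "d\<^sup>2 \<ge> 0" by simp
  ultimately have "s\<^sup>2 + y\<^sup>2 \<le> 2 * (s * y) + s * y / 36" "0 \<le> s * y" by linarith+
  then have "s\<^sup>2 + y\<^sup>2 \<le> 2 * 1.01915 * (s * y)" by simp
  then have "(s\<^sup>2 + y\<^sup>2) / y \<le> 2 * 1.01915 * s"
    using y by (simp add: pos_divide_le_eq algebra_simps)
  then have "s\<^sup>2 / y + y \<le> 2 * 1.01915 * s"
    using y by (simp add: add_divide_distrib power2_eq_square)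
  then show ?thesis using k unfolding y_def by (intro exI[of _ k]) simp
qed

text \<open>Up to the factor \<open>H\<close>, marginal costs depend on \<open>K\<close> and \<open>H\<close> only through
  \<open>s = sqrt (K / H)\<close>, and over \<open>x \<ge> L\<close> the marginal cost is least at \<open>max L s\<close>. Multipliers that are
  good at \<open>s = L\<close> and do not raise the mean interval above \<open>v * L\<close> also serve all \<open>s < L\<close>.\<close>

lemma mixture_rounding:
  fixes p d :: "nat \<Rightarrow> real" and K H x L v :: real
  assumes "K > 0" "H > 0" "L > 0" "x \<ge> L" "v \<ge> 0"
    and below: "\<exists>k. (\<forall>j<m. 0 < k j) \<and> (\<Sum>j<m. p j * (real (k j) * d j)) \<le> v * L \<and>
      (\<Sum>j<m. p j / (real (k j) * d j)) * L\<^sup>2 + (\<Sum>j<m. p j * (real (k j) * d j)) \<le> 2 * v * L"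
    and above: "\<And>s. s \<ge> L \<Longrightarrow> \<exists>k. (\<forall>j<m. 0 < k j) \<and>
      (\<Sum>j<m. p j / (real (k j) * d j)) * s\<^sup>2 + (\<Sum>j<m. p j * (real (k j) * d j)) \<le> 2 * v * s"
  shows "\<exists>k. (\<forall>j<m. (0::nat) < k j) \<and>
    (\<Sum>j<m. p j * marginal_cost K H (real (k j) * d j)) \<le> v * marginal_cost K H x"
proof -
  define s where "s = sqrt (K / H)"
  have s: "s > 0" "K = H * s\<^sup>2" using assms by (auto simp: s_def)
  have x: "x > 0" using assms by linarith
  have "\<exists>k. (\<forall>j<m. (0::nat) < k j) \<and>
      (\<Sum>j<m. p j / (real (k j) * d j)) * s\<^sup>2 + (\<Sum>j<m. p j * (real (k j) * d j)) \<le> v * (s\<^sup>2 / x + x)"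
  proof (cases "s \<ge> L")
    case True
    \<comment> \<open>By the inequality of arithmetic and geometric means, \<open>2 * s\<close>
      bounds the scaled marginal cost at every positive \<open>x\<close>.\<close>
    have "0 \<le> (s - x)\<^sup>2 / x" using x by simp
    then have "2 * s \<le> s\<^sup>2 / x + x"
      using x by (simp add: power2_eq_square field_simps)
    then have "v * (2 * s) \<le> v * (s\<^sup>2 / x + x)" using assms by (intro mult_left_mono)
    then have "2 * v * s \<le> v * (s\<^sup>2 / x + x)" by simp
    then show ?thesis using above[OF True] order_trans by blast
  next
    case False
    obtain k where k: "\<forall>j<m. 0 < k j" "(\<Sum>j<m. p j * (real (k j) * d j)) \<le> v * L"
      "(\<Sum>j<m. p j / (real (k j) * d j)) * L\<^sup>2 + (\<Sum>j<m. p j * (real (k j) * d j)) \<le> 2 * v * L"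
      using below by blast
    define a b where "a = (\<Sum>j<m. p j / (real (k j) * d j))"
      and "b = (\<Sum>j<m. p j * (real (k j) * d j))"
    \<comment> \<open>Weighting the bound at \<open>L\<close> by the square of \<open>s\<close> and
      the bound on the mean by the difference of the squares of \<open>L\<close> and
      \<open>s\<close> combines them into a bound at \<open>s\<close>.\<close>
    have "s\<^sup>2 * (a * L\<^sup>2 + b) \<le> s\<^sup>2 * (2 * v * L)" using k(3) unfolding a_def b_def by (intro mult_left_mono) auto
    moreover have "s\<^sup>2 \<le> L\<^sup>2" using False s by (intro power_mono) auto
    then have "(L\<^sup>2 - s\<^sup>2) * b \<le> (L\<^sup>2 - s\<^sup>2) * (v * L)" using k(2) unfolding b_def by (intro mult_left_mono) auto
    ultimately have "L\<^sup>2 * (a * s\<^sup>2 + b) \<le> v * L * (s\<^sup>2 + L\<^sup>2)" by (simp add: algebra_simps)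
    also have "\<dots> = L\<^sup>2 * (v * (s\<^sup>2 / L + L))"
      using \<open>L > 0\<close> by (simp add: power2_eq_square field_simps)
    finally have "a * s\<^sup>2 + b \<le> v * (s\<^sup>2 / L + L)" using \<open>L > 0\<close> by simp
    \<comment> \<open>For \<open>s\<close> below \<open>L\<close>, the marginal cost is increasing
      from \<open>L\<close> on.\<close>
    also have "s\<^sup>2 / L + L \<le> s\<^sup>2 / x + x"
    proof -
      have "s\<^sup>2 \<le> L * x" using \<open>s\<^sup>2 \<le> L\<^sup>2\<close> assms by (smt (verit) power2_eq_square mult_left_mono)
      then have "0 \<le> (x - L) * (L * x - s\<^sup>2) / (L * x)" using assms x by simp
      also have "\<dots> = s\<^sup>2 / x + x - (s\<^sup>2 / L + L)"
        using assms x by (simp add: field_simps power2_eq_square)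
      finally show ?thesis by simp
    qed
    finally show ?thesis using k(1) assms unfolding a_def b_def by (auto intro: mult_left_mono)
  qed
  then obtain k where k: "\<forall>j<m. (0::nat) < k j"
    "(\<Sum>j<m. p j / (real (k j) * d j)) * s\<^sup>2 + (\<Sum>j<m. p j * (real (k j) * d j)) \<le> v * (s\<^sup>2 / x + x)"
    by blast
  have "(\<Sum>j<m. p j * marginal_cost K H (real (k j) * d j))
      = H * ((\<Sum>j<m. p j / (real (k j) * d j)) * s\<^sup>2 + (\<Sum>j<m. p j * (real (k j) * d j)))"
    unfolding marginal_cost_def s(2)
    by (simp add: sum_distrib_left sum_distrib_right sum.distrib[symmetric] ring_distribs)
      (intro sum.cong; simp add: algebra_simps)
  also have "\<dots> \<le> H * (v * (s\<^sup>2 / x + x))" using k(2) assms by (intro mult_left_mono) auto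
  also have "\<dots> = v * marginal_cost K H x"
    unfolding marginal_cost_def s(2) by (simp add: algebra_simps)
  finally show ?thesis using k(1) by blast
qed

text \<open>Each spacing meets the bound on its own, hence so does the average. This covers the
  unbounded range of \<open>s\<close> that endpoint checks cannot reach.\<close>

lemma nearest_multiples_mixture:
  fixes p d :: "nat \<Rightarrow> real"
  assumes "\<And>j. j < m \<Longrightarrow> d j > 0" "\<And>j. j < m \<Longrightarrow> 3 * d j \<le> s" "\<And>j. j < m \<Longrightarrow> p j \<ge> 0" "sum p {..<m} = 1"
  shows "\<exists>k. (\<forall>j<m. (0::nat) < k j) \<and>
    (\<Sum>j<m. p j / (real (k j) * d j)) * s\<^sup>2 + (\<Sum>j<m. p j * (real (k j) * d j)) \<le> 2 * 1.01915 * s"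
proof -
  obtain k :: "nat \<Rightarrow> nat" where k: "\<And>j. j < m \<Longrightarrow> k j > 0 \<and> s\<^sup>2 / (real (k j) * d j) + real (k j) * d j \<le> 2 * 1.01915 * s"
    using nearest_multiple[of "d _" s] assms(1,2) by metis
  have "(\<Sum>j<m. p j / (real (k j) * d j)) * s\<^sup>2 + (\<Sum>j<m. p j * (real (k j) * d j))
      = (\<Sum>j<m. p j * (s\<^sup>2 / (real (k j) * d j) + real (k j) * d j))"
    by (simp add: sum_distrib_right sum.distrib[symmetric] ring_distribs)
  also have "\<dots> \<le> (\<Sum>j<m. p j * (2 * 1.01915 * s))"
    using k assms by (intro sum_mono mult_left_mono) auto
  also have "\<dots> = 2 * 1.01915 * s" unfolding sum_distrib_right[symmetric] assms(4) by simp
  finally show ?thesis using k by blast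
qed

text \<open>The mixture of four spacings and its breakpoints below were found numerically, by a search
  around the solution of the linear program that minimises the worst expected cost ratio.\<close>

definition "two_weights = (!) [0.85, 0.15 :: real]"
definition "two_spacings = (!) [1, 1.1 :: real]"
definition "four_weights = (!) [0.29, 0.25, 0.18, 0.28 :: real]"
definition "four_spacings = (!) [0.57, 0.77, 0.91, 1.17 :: real]"

lemmas two_defs = two_weights_def two_spacings_def
lemmas four_defs = four_weights_def four_spacings_def

section \<open>Endpoint checks for the two mixtures\<close>

lemma sum_lessThan_2: "(\<Sum>j<2. f j) = f 0 + f (Suc 0)"
  and sum_lessThan_4: "(\<Sum>j<4. f j) = f 0 + f 1 + f 2 + f (3::nat)"
  by (simp_all add: eval_nat_numeral)

lemma all_less_4: "(\<forall>j<4. P j) \<longleftrightarrow> P 0 \<and> P 1 \<and> P 2 \<and> P (3::nat)"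
  by (auto simp: eval_nat_numeral less_Suc_eq)

text \<open>Spacing 1 alone fails near \<open>s = sqrt 6\<close>, where the multiples 2 and 3 both
  cost a factor of about 1.0206. Some weight on 1.1 brings this below 1.01915.\<close>

lemma two_spacings_above:
  assumes "s \<ge> 2"
  shows "\<exists>k. (\<forall>j<2. (0::nat) < k j) \<and>
    (\<Sum>j<2. two_weights j / (real (k j) * two_spacings j)) * s\<^sup>2
      + (\<Sum>j<2. two_weights j * (real (k j) * two_spacings j)) \<le> 2 * 1.01915 * s"
proof -
  \<comment> \<open>The list \<open>k\<close> holds one multiplier per spacing, fixed on the whole
    piece; only the two endpoints remain to be evaluated.\<close>
  have piece: ?thesis
    if "lo \<le> s" "s \<le> hi" "list_all (\<lambda>i. 0 < i) k" "length k = 2"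
      "(\<Sum>j<2. two_weights j / (real (k ! j) * two_spacings j)) * lo\<^sup>2
        + (\<Sum>j<2. two_weights j * (real (k ! j) * two_spacings j)) \<le> 2 * 1.01915 * lo"
      "(\<Sum>j<2. two_weights j / (real (k ! j) * two_spacings j)) * hi\<^sup>2
        + (\<Sum>j<2. two_weights j * (real (k ! j) * two_spacings j)) \<le> 2 * 1.01915 * hi"
    for lo hi k
  proof (intro exI[of _ "(!) k"] conjI)
    show "\<forall>j<2. 0 < k ! j" using that by (simp add: list_all_length)
    have "(\<Sum>j<2. two_weights j / (real (k ! j) * two_spacings j)) \<ge> 0"
      by (simp add: sum_lessThan_2 two_defs)
    from quadratic_le_on_interval[OF this that(1,2,5,6)]
    show "(\<Sum>j<2. two_weights j / (real (k ! j) * two_spacings j)) * s\<^sup>2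
        + (\<Sum>j<2. two_weights j * (real (k ! j) * two_spacings j)) \<le> 2 * 1.01915 * s" .
  qed
  consider "s \<le> 2.45" | "2.45 \<le> s" "s \<le> 3.35" | "3.35 \<le> s" by linarith
  then show ?thesis
  proof cases
    case 1
    then show ?thesis using assms
      by (intro piece[of 2 "2.45" "[2, 2]"]) (simp_all add: sum_lessThan_2 two_defs power2_eq_square)
  next
    case 2
    then show ?thesis
      by (intro piece[of "2.45" "3.35" "[3, 2]"]) (simp_all add: sum_lessThan_2 two_defs power2_eq_square)
  next
    case 3
    \<comment> \<open>Here \<open>3 * 1.1\<close> is at most 3.35.\<close>
    then show ?thesis
      by (intro nearest_multiples_mixture)
        (auto simp: sum_lessThan_2 two_defs less_Suc_eq numeral_2_eq_2)
  qed
qed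

lemma four_spacings_above:
  assumes "s \<ge> 1"
  shows "\<exists>k. (\<forall>j<4. (0::nat) < k j) \<and>
    (\<Sum>j<4. four_weights j / (real (k j) * four_spacings j)) * s\<^sup>2
      + (\<Sum>j<4. four_weights j * (real (k j) * four_spacings j)) \<le> 2 * 1.01915 * s"
proof -
  have piece: ?thesis
    if "lo \<le> s" "s \<le> hi" "list_all (\<lambda>i. 0 < i) k" "length k = 4"
      "(\<Sum>j<4. four_weights j / (real (k ! j) * four_spacings j)) * lo\<^sup>2
        + (\<Sum>j<4. four_weights j * (real (k ! j) * four_spacings j)) \<le> 2 * 1.01915 * lo"
      "(\<Sum>j<4. four_weights j / (real (k ! j) * four_spacings j)) * hi\<^sup>2
        + (\<Sum>j<4. four_weights j * (real (k ! j) * four_spacings j)) \<le> 2 * 1.01915 * hi"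
    for lo hi k
  proof (intro exI[of _ "(!) k"] conjI)
    show "\<forall>j<4. 0 < k ! j" using that by (simp add: list_all_length)
    have "(\<Sum>j<4. four_weights j / (real (k ! j) * four_spacings j)) \<ge> 0"
      by (simp add: sum_lessThan_4 four_defs)
    from quadratic_le_on_interval[OF this that(1,2,5,6)]
    show "(\<Sum>j<4. four_weights j / (real (k ! j) * four_spacings j)) * s\<^sup>2
        + (\<Sum>j<4. four_weights j * (real (k ! j) * four_spacings j)) \<le> 2 * 1.01915 * s" .
  qed
  note simps = sum_lessThan_4 four_defs power2_eq_square
  consider "s \<le> 1.089" | "1.089 \<le> s" "s \<le> 1.298" | "1.298 \<le> s" "s \<le> 1.431"
    | "1.431 \<le> s" "s \<le> 1.66" | "1.66 \<le> s" "s \<le> 2.05" | "2.05 \<le> s" "s \<le> 2.85"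
    | "2.85 \<le> s" "s \<le> 4" | "4 \<le> s" by linarith
  then show ?thesis
  proof cases
    case 1
    then show ?thesis using assms
      by (intro piece[of 1 "1.089" "[2, 1, 1, 1]"]) (simp_all add: simps)
  next
    case 2
    then show ?thesis
      by (intro piece[of "1.089" "1.298" "[2, 2, 1, 1]"]) (simp_all add: simps)
  next
    case 3
    then show ?thesis
      by (intro piece[of "1.298" "1.431" "[2, 2, 2, 1]"]) (simp_all add: simps)
  next
    case 4
    then show ?thesis
      by (intro piece[of "1.431" "1.66" "[3, 2, 2, 1]"]) (simp_all add: simps)
  next
    case 5
    then show ?thesis
      by (intro piece[of "1.66" "2.05" "[3, 2, 2, 2]"]) (simp_all add: simps)
  next
    case 6
    then show ?thesis
      by (intro piece[of "2.05" "2.85" "[4, 3, 3, 2]"]) (simp_all add: simps)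
  next
    case 7
    then show ?thesis
      by (intro piece[of "2.85" 4 "[6, 4, 4, 3]"]) (simp_all add: simps)
  next
    case 8
    \<comment> \<open>Here \<open>3 * 1.17\<close> is at most 4.\<close>
    then show ?thesis
      by (intro nearest_multiples_mixture)
        (auto simp: sum_lessThan_4 four_defs less_Suc_eq eval_nat_numeral)
  qed
qed

text \<open>For \<open>x = 1\<close> all multipliers are 1: the coefficient of \<open>K\<close>
  becomes about 0.986 and that of \<open>H\<close> becomes 1.015, both within the bound whatever
  \<open>K\<close> and \<open>H\<close> are. The other case uses \<open>L = 2\<close>.\<close>

lemma two_spacings_round:
  assumes "K > 0" "H > 0" "x = 1 \<or> x \<ge> 2"
  shows "\<exists>k. (\<forall>j<2. (0::nat) < k j) \<and>
    (\<Sum>j<2. two_weights j * marginal_cost K H (real (k j) * two_spacings j))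
      \<le> 1.01915 * marginal_cost K H x"
  using assms(3)
proof
  assume "x = 1"
  then show ?thesis
    using assms by (intro exI[of _ "\<lambda>_. 1"]) (simp add: sum_lessThan_2 two_defs marginal_cost_def, argo)
next
  assume "x \<ge> 2"
  show ?thesis
  proof (rule mixture_rounding[OF assms(1,2) _ \<open>x \<ge> 2\<close> _ _ two_spacings_above])
    show "\<exists>k. (\<forall>j<2. 0 < k j) \<and> (\<Sum>j<2. two_weights j * (real (k j) * two_spacings j)) \<le> 1.01915 * 2 \<and>
      (\<Sum>j<2. two_weights j / (real (k j) * two_spacings j)) * 2\<^sup>2
        + (\<Sum>j<2. two_weights j * (real (k j) * two_spacings j)) \<le> 2 * 1.01915 * 2"
      by (intro exI[of _ "\<lambda>_. 2"]) (simp add: sum_lessThan_2 two_defs)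
  qed auto
qed

lemma four_spacings_round:
  assumes "K > 0" "H > 0" "x \<ge> 1"
  shows "\<exists>k. (\<forall>j<4. (0::nat) < k j) \<and>
    (\<Sum>j<4. four_weights j * marginal_cost K H (real (k j) * four_spacings j))
      \<le> 1.01915 * marginal_cost K H x"
proof (rule mixture_rounding[OF assms(1,2) _ assms(3) _ _ four_spacings_above])
  show "\<exists>k. (\<forall>j<4. 0 < k j) \<and> (\<Sum>j<4. four_weights j * (real (k j) * four_spacings j)) \<le> 1.01915 * 1 \<and>
    (\<Sum>j<4. four_weights j / (real (k j) * four_spacings j)) * 1\<^sup>2
      + (\<Sum>j<4. four_weights j * (real (k j) * four_spacings j)) \<le> 2 * 1.01915 * 1"
    \<comment> \<open>Doubling only the smallest spacing gives the mean interval 1.0145.\<close>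
    by (intro exI[of _ "(!) [2, 1, 1, 1]"]) (simp add: sum_lessThan_4 four_defs all_less_4)
qed auto

subsection \<open>Comparison of costs\<close>

abbreviation "evenly_spaced_costs n K0 K H \<equiv>
  {evenly_spaced_cost n K0 K H \<Delta> T |\<Delta> T. evenly_spaced_policy n \<Delta> T}"

lemma Inf_evenly_spaced_le:
  assumes "K0 > 0"
    and "\<And>i. i \<in> {1..n} \<Longrightarrow> K i > 0" "\<And>i. i \<in> {1..n} \<Longrightarrow> H i > 0"
    and "evenly_spaced_policy n \<Delta> T"
  shows "Inf (evenly_spaced_costs n K0 K H) \<le> evenly_spaced_cost n K0 K H \<Delta> T"
proof (rule cInf_lower)
  have "0 \<le> evenly_spaced_cost n K0 K H \<Delta> T" if "evenly_spaced_policy n \<Delta> T" for \<Delta> T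
  proof -
    have "T i > 0" if "i \<in> {1..n}" for i
      using that \<open>evenly_spaced_policy n \<Delta> T\<close> unfolding evenly_spaced_policy_def by fastforce
    then have "0 \<le> (\<Sum>i=1..n. marginal_cost (K i) (H i) (T i))"
      unfolding marginal_cost_def using assms(2,3) by (intro sum_nonneg) (simp add: less_imp_le)
    then show ?thesis
      using that assms(1) unfolding evenly_spaced_cost_def evenly_spaced_policy_def by simp
  qed
  then show "bdd_below (evenly_spaced_costs n K0 K H)" by (auto intro!: bdd_belowI[of _ 0])
qed (use assms in auto)

text \<open>The infimum is at most the cost at each spacing, hence at most the weighted average.
  Exchanging the sums then allows a separate estimate for each commodity, although no single spacing
  need suit all of them.\<close>

lemma Inf_evenly_spaced_le_mixture:
  fixes p d :: "nat \<Rightarrow> real"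
  assumes pos: "K0 > 0" "\<And>i. i \<in> {1..n} \<Longrightarrow> K i > 0" "\<And>i. i \<in> {1..n} \<Longrightarrow> H i > 0"
    and \<tau>: "\<tau> > 0" and d: "\<And>j. j < m \<Longrightarrow> d j > 0"
    and p: "\<And>j. j < m \<Longrightarrow> p j \<ge> 0" "sum p {..<m} = 1"
    and joint: "(\<Sum>j<m. p j / d j) * (K0 / \<tau>) \<le> v * joint_cost n K0 T"
    and round: "\<And>i. i \<in> {1..n} \<Longrightarrow> \<exists>k. (\<forall>j<m. (0::nat) < k j) \<and>
      (\<Sum>j<m. p j * marginal_cost (K i / \<tau>) (H i * \<tau>) (real (k j) * d j))
        \<le> v * marginal_cost (K i / \<tau>) (H i * \<tau>) (T i / \<tau>)"
  shows "Inf (evenly_spaced_costs n K0 K H) \<le> v * policy_cost n K0 K H T"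
proof -
  obtain k :: "nat \<Rightarrow> nat \<Rightarrow> nat" where k: "\<And>i. i \<in> {1..n} \<Longrightarrow> (\<forall>j<m. 0 < k i j) \<and>
      (\<Sum>j<m. p j * marginal_cost (K i / \<tau>) (H i * \<tau>) (real (k i j) * d j))
        \<le> v * marginal_cost (K i / \<tau>) (H i * \<tau>) (T i / \<tau>)"
    using round by metis
  \<comment> \<open>Time is measured in units of \<tau>, which will be the smallest
    interval.\<close>
  have scale: "marginal_cost (a / \<tau>) (b * \<tau>) y = marginal_cost a b (y * \<tau>)" for a b y
    using \<tau> by (simp add: marginal_cost_def)
  let ?T = "\<lambda>j i. real (k i j) * (d j * \<tau>)"
  have "Inf (evenly_spaced_costs n K0 K H) = (\<Sum>j<m. p j * Inf (evenly_spaced_costs n K0 K H))"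
    unfolding sum_distrib_right[symmetric] p(2) by simp
  also have "\<dots> \<le> (\<Sum>j<m. p j * evenly_spaced_cost n K0 K H (d j * \<tau>) (?T j))"
  proof (intro sum_mono mult_left_mono)
    fix j assume j: "j \<in> {..<m}"
    show "0 \<le> p j" using p(1) j by simp
    have "evenly_spaced_policy n (d j * \<tau>) (?T j)"
      unfolding evenly_spaced_policy_def using d \<tau> j k by (metis lessThan_iff mult_pos_pos)
    then show "Inf (evenly_spaced_costs n K0 K H) \<le> evenly_spaced_cost n K0 K H (d j * \<tau>) (?T j)"
      by (intro Inf_evenly_spaced_le pos)
  qed
  also have "\<dots> = (\<Sum>j<m. p j / d j) * (K0 / \<tau>)
      + (\<Sum>j<m. p j * (\<Sum>i=1..n. marginal_cost (K i) (H i) (?T j i)))"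
    unfolding evenly_spaced_cost_def by (simp add: ring_distribs sum.distrib sum_distrib_right sum_divide_distrib)
  also have "(\<Sum>j<m. p j * (\<Sum>i=1..n. marginal_cost (K i) (H i) (?T j i)))
      = (\<Sum>i=1..n. \<Sum>j<m. p j * marginal_cost (K i / \<tau>) (H i * \<tau>) (real (k i j) * d j))"
    unfolding sum_distrib_left scale by (subst sum.swap) (simp add: mult.assoc)
  also have "\<dots> \<le> (\<Sum>i=1..n. v * marginal_cost (K i / \<tau>) (H i * \<tau>) (T i / \<tau>))"
    using k by (intro sum_mono) blast
  also have "\<dots> = v * (\<Sum>i=1..n. marginal_cost (K i) (H i) (T i))"
    using \<tau> by (simp add: scale sum_distrib_left)
  finally show ?thesis using joint by (simp add: policy_cost_def ring_distribs)
qed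

lemma Inf_evenly_spaced_le_policy:
  assumes pos: "K0 > 0" "\<And>i. i \<in> {1..n} \<Longrightarrow> K i > 0" "\<And>i. i \<in> {1..n} \<Longrightarrow> H i > 0"
    and T: "replenishment_policy n T" and "n > 0"
  shows "Inf (evenly_spaced_costs n K0 K H) \<le> 1.01915 * policy_cost n K0 K H T"
proof -
  define \<tau> where "\<tau> = Min (T ` {1..n})"
  have "\<tau> \<in> T ` {1..n}" unfolding \<tau>_def using \<open>n > 0\<close> by (intro Min_in) auto
  then obtain i0 where i0: "i0 \<in> {1..n}" "T i0 = \<tau>" by auto
  have min: "\<tau> \<le> T i" if "i \<in> {1..n}" for i unfolding \<tau>_def using that by (intro Min_le) auto
  have Tpos: "\<forall>i\<in>{1..n}. T i > 0" using T by (simp add: replenishment_policy_def)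
  then have \<tau>: "\<tau> > 0" using i0 by auto
  have pos': "K i / \<tau> > 0" "H i * \<tau> > 0" if "i \<in> {1..n}" for i using pos that \<tau> by auto
  show ?thesis
  proof (cases "\<exists>l\<in>{1..n}. \<tau> < T l \<and> T l < 2 * \<tau>")
    case True
    then have J: "joint_cost n K0 T \<ge> 5 / 4 * K0 / \<tau>"
      using joint_cost_ge_two[of K0 n T i0] Tpos i0 pos by auto
    show ?thesis
    proof (rule Inf_evenly_spaced_le_mixture[where m = 4 and d = four_spacings and p = four_weights and \<tau> = \<tau>])
      \<comment> \<open>The sum is about 1.2706, against 1.2739 on the right: the factor 5/4 is
        nearly exhausted.\<close>
      have "(\<Sum>j<4. four_weights j / four_spacings j) * (K0 / \<tau>) \<le> (1.01915 * (5 / 4)) * (K0 / \<tau>)"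
        using pos \<tau> by (intro mult_right_mono) (simp_all add: sum_lessThan_4 four_defs)
      then show "(\<Sum>j<4. four_weights j / four_spacings j) * (K0 / \<tau>) \<le> 1.01915 * joint_cost n K0 T"
        using J by simp
      fix i assume i: "i \<in> {1..n}"
      have "T i / \<tau> \<ge> 1" using min[OF i] \<tau> by simp
      from four_spacings_round[OF pos'[OF i] this]
      show "\<exists>k. (\<forall>j<4. (0::nat) < k j) \<and>
          (\<Sum>j<4. four_weights j * marginal_cost (K i / \<tau>) (H i * \<tau>) (real (k j) * four_spacings j))
            \<le> 1.01915 * marginal_cost (K i / \<tau>) (H i * \<tau>) (T i / \<tau>)" .
    qed (use pos \<tau> in \<open>auto simp: sum_lessThan_4 four_defs less_Suc_eq eval_nat_numeral\<close>)
  next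
    case False
    have J: "joint_cost n K0 T \<ge> K0 / \<tau>"
      using joint_cost_ge_single[of K0 n T i0] Tpos i0 pos by auto
    show ?thesis
    proof (rule Inf_evenly_spaced_le_mixture[where m = 2 and d = two_spacings and p = two_weights and \<tau> = \<tau>])
      have "(\<Sum>j<2. two_weights j / two_spacings j) * (K0 / \<tau>) \<le> 1.01915 * (K0 / \<tau>)"
        using pos \<tau> by (intro mult_right_mono) (simp_all add: sum_lessThan_2 two_defs)
      also have "\<dots> \<le> 1.01915 * joint_cost n K0 T" by (rule mult_left_mono[OF J]) simp
      finally show "(\<Sum>j<2. two_weights j / two_spacings j) * (K0 / \<tau>) \<le> 1.01915 * joint_cost n K0 T" .
    next
      fix i assume i: "i \<in> {1..n}"
      have "T i / \<tau> = 1 \<or> T i / \<tau> \<ge> 2"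
        using False min[OF i] i \<tau> by (force simp: pos_le_divide_eq)
      from two_spacings_round[OF pos'[OF i] this]
      show "\<exists>k. (\<forall>j<2. (0::nat) < k j) \<and>
          (\<Sum>j<2. two_weights j * marginal_cost (K i / \<tau>) (H i * \<tau>) (real (k j) * two_spacings j))
            \<le> 1.01915 * marginal_cost (K i / \<tau>) (H i * \<tau>) (T i / \<tau>)" .
    qed (use pos \<tau> in \<open>auto simp: sum_lessThan_2 two_defs less_Suc_eq numeral_2_eq_2\<close>)
  qed
qed

text \<open>Without commodities there is no smallest interval to scale by, but the cost
  \<open>K0 / \<Delta>\<close> can be made arbitrarily small.\<close>

lemma Inf_evenly_spaced_no_commodities:
  assumes "K0 > 0"
  shows "Inf (evenly_spaced_costs 0 K0 K H) \<le> 0"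
proof (rule ccontr)
  assume "\<not> Inf (evenly_spaced_costs 0 K0 K H) \<le> 0"
  define r where "r = Inf (evenly_spaced_costs 0 K0 K H)"
  have r: "r > 0" using \<open>\<not> _\<close> by (simp add: r_def)
  \<comment> \<open>This spacing costs \<open>r / 2\<close>, below the supposed infimum
    \<open>r\<close>.\<close>
  have "evenly_spaced_policy 0 (2 * K0 / r) (\<lambda>_. 1)"
    using assms r by (simp add: evenly_spaced_policy_def)
  then have "r \<le> evenly_spaced_cost 0 K0 K H (2 * K0 / r) (\<lambda>_. 1)"
    unfolding r_def using assms by (intro Inf_evenly_spaced_le) auto
  then show False using assms r by (simp add: evenly_spaced_cost_def)
qed

theorem theorem1p5:
  fixes n :: nat and K0 :: real and K H :: "nat \<Rightarrow> real"
  assumes "K0 > 0"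
    and "\<And>i. i \<in> {1..n} \<Longrightarrow> K i > 0"
    and "\<And>i. i \<in> {1..n} \<Longrightarrow> H i > 0"
  shows "Inf {evenly_spaced_cost n K0 K H \<Delta> T |\<Delta> T. evenly_spaced_policy n \<Delta> T}
         \<le> 1.01915 * Inf {policy_cost n K0 K H T |T. replenishment_policy n T}"
proof -
  define E where "E = Inf (evenly_spaced_costs n K0 K H)"
  \<comment> \<open>With the constant on the left, it suffices to bound each policy cost from
    below.\<close>
  have "E / 1.01915 \<le> Inf {policy_cost n K0 K H T |T. replenishment_policy n T}"
  proof (rule cInf_greatest)
    show "{policy_cost n K0 K H T |T. replenishment_policy n T} \<noteq> {}"
      by (auto simp: replenishment_policy_def intro!: exI[of _ "\<lambda>_. 1"])
  next
    fix c assume "c \<in> {policy_cost n K0 K H T |T. replenishment_policy n T}"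
    then obtain T where T: "c = policy_cost n K0 K H T" "replenishment_policy n T" by blast
    have "E \<le> 1.01915 * c"
    proof (cases "n = 0")
      case True
      have "joint_cost 0 K0 T \<ge> K0 * 0"
        by (rule joint_cost_ge[where c = 0]) (use assms(1) in auto)
      then have "0 \<le> c" using T(1) True by (simp add: policy_cost_def)
      moreover have "E \<le> 0"
        unfolding E_def True by (rule Inf_evenly_spaced_no_commodities[OF assms(1)])
      moreover have "0 \<le> 1.01915 * c" using \<open>0 \<le> c\<close> by simp
      ultimately show ?thesis by (meson order_trans)
    next
      case False
      then show ?thesis
        unfolding E_def T(1) by (intro Inf_evenly_spaced_le_policy assms T(2)) auto
    qed
    then show "E / 1.01915 \<le> c" by simp
  qed
  then show ?thesis unfolding E_def[symmetric] by simp
qed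

end
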